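(* Consider a piecewise-deterministic Markov process on $E$ satisfying the assumptions listed in the context, with arbitrary initial distribution $\nu_0$ of $Z_0$. Let $n\ge0$ be an integer. The conditional distribution of $S_{n+1}$ given $Z_n,Z_{n+1}$ satisfies, for any $t\ge0$, $$\mathbf{P}_{\nu_0}(S_{n+1}>t\mid Z_n,Z_{n+1})=\exp\left(-\int_0^{t\wedge t^\star(Z_n)}\widetilde\lambda(Z_n,Z_{n+1},s)\,ds\right)\mathbf{1}_{\{0\le t<t^\star(Z_n)\}}$$ (almost surely), where the jump rate $\widetilde\lambda$ is defined for any $x,y\in E$, $0\le t\le t^\star(x)$, by $$\widetilde\lambda(x,y,t)=\frac{f(x,t)\widetilde Q(x,t,y)}{\int_t^{t^\star(x)}f(x,s)\widetilde Q(x,s,y)\,ds+G(x,t^\star(x))\widetilde Q(x,t^\star(x),y)}.$$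
   Context: **Process.** $E$ is a nonempty open subset of a separable metric space $(\mathcal{E},d)$; all functions and kernels are Borel measurable. $\Phi:E\times\mathbf{R}_+\to\overline{E}$ is a flow: $\Phi(\xi,t+s)=\Phi(\Phi(\xi,t),s)$ (whenever the right side is defined), and $t^\star(\xi)=\inf\{t>0:\Phi(\xi,t)\in\partial E\}$. The jump rate $\lambda:\overline{E}\to\mathbf{R}_+$ satisfies: for all $\xi\in E$ there is $\varepsilon>0$ with $\int_0^\varepsilon\lambda(\Phi(\xi,s))\,ds<\infty$. $Q$ is a Markov kernel on $\overline{E}$ with $Q(\xi,\overline{E}\setminus\{\xi\})=1$ and $Q(\xi,E)=1$ for all $\xi\in\overline E$. Put $\overline\lambda(\xi,t)=\lambda(\Phi(\xi,t))$, $\overline Q(\xi,t,B)=Q(\Phi(\xi,t),B)$, $G(\xi,t)=\exp(-\int_0^t\overline\lambda(\xi,s)\,ds)$, $f(\xi,t)=\overline\lambda(\xi,t)G(\xi,t)$. The embedded chain $(Z_n,S_n)_{n\ge0}$ ($Z_n$ post-jump locations, $S_n$ interarrival times, $S_0=0$) satisfies: $Z_0\sim\nu_0$ and for every $n\ge 0$, conditionally on the past up to index $n$ with $Z_n=x$, $\mathbf{P}_{\nu_0}(S_{n+1}>t)=G(x,t)\mathbf{1}_{\{0\le t<t^\star(x)\}}$, and, given moreover $S_{n+1}=s$, $Z_{n+1}$ has law $\overline Q(x,s,\cdot)$. **Assumptions.** Let $\mathcal{C}_1$ be the set of Borel subsets of $E$ with non-empty interior. Let $d_2((x,y),(u,v))=d(x,u)+d(y,v)$.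 (1a) $\overline Q(\xi,s,B)=\int_B\widetilde Q(\xi,s,y)\,\mu(dy)$, where $\mu$ is a measure on $E$ with $\mu(B)>0$ for every measurable $B$ with non-empty interior. (1b) $\widetilde Q(x,\cdot,y)$ is continuous for all $x,y\in E$. (1c) There is $m>0$ with $\widetilde Q(x,s,y)\ge m$ for all $x,y\in E,s\ge0$. (1d) For any $e>0$ there exist $p\ge2$ and pairwise non-overlapping (disjoint) sets $B_1,\dots,B_p\in\mathcal{C}_1$ with $\max_k\operatorname{diam}B_k<e$ and $\sum_{k=1}^p\overline Q(x,t,B_k)=1$ for all $x\in E,t\ge0$. (2a) $f(\xi,\cdot)$ is strictly positive and continuous for every $\xi\in E$. (2b) There is a locally integrable $M:\mathbf{R}_+\to\mathbf{R}_+$ with $\overline\lambda(\xi,t)\le M(t)$ for all $\xi\in E$, $t\geq 0$. (2c) $t^\star:E\to\mathbf{R}_+$ is bounded. (2d) There is a constant $[f\widetilde Q]_{Lip}$ with $|f(x,t)\widetilde Q(x,t,y)-f(u,t)\widetilde Q(u,t,v)|\le[f\widetilde Q]_{Lip}\,d_2((x,y),(u,v))$ for all $x,y,u,v\in E$, $0\le t<t^\star(x)\wedge t^\star(u)$. (2e) There is a constant $[f]_{Lip}$ with $|f(x,t)-f(y,t)|\le[f]_{Lip}\,d(x,y)$ for all $x,y\in E$, $t\ge0$. (2f) There is a constant $[G\widetilde Q]_{Lip}$ with $|G(x,t^\star(x))\widetilde Q(x,t^\star(x),y)-G(u,t^\star(u))\widetilde Q(u,t^\star(u),v)|\le[G\widetilde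 Q]_{Lip}\,d_2((x,y),(u,v))$ for all $x,y,u,v\in E$. *)

theory Defs
  imports "HOL-Probability.Probability"
begin

text \<open>
  The ambient separable metric space is a type of class
  \<open>{metric_space, second_countable_topology}\<close> (for metric spaces, separable and second
  countable agree). Objects living on a subset \<open>A\<close> are functions on the whole type, constrained
  only on \<open>A\<close>; measurability is with respect to \<open>restrict_space borel A\<close>.
\<close>

abbreviation (input) borel_on :: "'a::topological_space set \<Rightarrow> 'a measure" where
  "borel_on A \<equiv> restrict_space borel A"

text \<open>Extended-real valued, so that the infimum of the empty set is \<open>\<infinity>\<close>.\<close>

definition exit_time :: "'a::topological_space set \<Rightarrow> ('a \<Rightarrow> real \<Rightarrow> 'a) \<Rightarrow> 'a \<Rightarrow> ereal" where
  "exit_time E \<Phi> \<xi> = Inf (ereal ` {t. 0 < t \<and> \<Phi> \<xi> t \<in> frontier E})"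

definition rate_along :: "('a \<Rightarrow> real \<Rightarrow> 'a) \<Rightarrow> ('a \<Rightarrow> real) \<Rightarrow> 'a \<Rightarrow> real \<Rightarrow> real" where
  "rate_along \<Phi> lam \<xi> t = lam (\<Phi> \<xi> t)"

definition kernel_along :: "('a \<Rightarrow> real \<Rightarrow> 'a) \<Rightarrow> ('a \<Rightarrow> 'a measure) \<Rightarrow> 'a \<Rightarrow> real \<Rightarrow> 'a measure" where
  "kernel_along \<Phi> Q \<xi> t = Q (\<Phi> \<xi> t)"

text \<open>
  The Lebesgue integral below has the default value \<open>0\<close> when the rate is not integrable on
  \<open>[0,t]\<close>; this never happens when the rate along the flow is dominated by a locally
  integrable function.
\<close>

definition surv :: "('a \<Rightarrow> real \<Rightarrow> 'a) \<Rightarrow> ('a \<Rightarrow> real) \<Rightarrow> 'a \<Rightarrow> real \<Rightarrow> real" where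
  "surv \<Phi> lam \<xi> t = exp (- (LBINT s:{0..t}. rate_along \<Phi> lam \<xi> s))"

definition dens :: "('a \<Rightarrow> real \<Rightarrow> 'a) \<Rightarrow> ('a \<Rightarrow> real) \<Rightarrow> 'a \<Rightarrow> real \<Rightarrow> real" where
  "dens \<Phi> lam \<xi> t = rate_along \<Phi> lam \<xi> t * surv \<Phi> lam \<xi> t"

text \<open>
  The rate of the interarrival time given both end points; \<open>Qt\<close> is the density of the transition
  kernel. It is meant for \<open>x, y \<in> E\<close> and \<open>0 \<le> t \<le> exit_time E \<Phi> x < \<infinity>\<close>.
\<close>

definition cond_rate ::
  "'a::topological_space set \<Rightarrow> ('a \<Rightarrow> real \<Rightarrow> 'a) \<Rightarrow> ('a \<Rightarrow> real) \<Rightarrow> ('a \<Rightarrow> real \<Rightarrow> 'a \<Rightarrow> real)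
     \<Rightarrow> 'a \<Rightarrow> 'a \<Rightarrow> real \<Rightarrow> real" where
  "cond_rate E \<Phi> lam Qt x y t =
     (let T = real_of_ereal (exit_time E \<Phi> x) in
      dens \<Phi> lam x t * Qt x t y /
        ((LBINT s:{t..T}. dens \<Phi> lam x s * Qt x s y) + surv \<Phi> lam x T * Qt x T y))"

definition C1 :: "'a::topological_space set \<Rightarrow> 'a set set" where
  "C1 E = {B \<in> sets borel. B \<subseteq> E \<and> interior B \<noteq> {}}"

definition d2 :: "'a::metric_space \<times> 'a \<Rightarrow> 'a \<times> 'a \<Rightarrow> real" where
  "d2 p q = dist (fst p) (fst q) + dist (snd p) (snd q)"

locale pdmp =
  fixes E :: "'a::{metric_space, second_countable_topology} set"
    and \<Phi> :: "'a \<Rightarrow> real \<Rightarrow> 'a"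
    and lam :: "'a \<Rightarrow> real"
    and Q :: "'a \<Rightarrow> 'a measure"
  assumes open_E: "open E"
    and nonempty_E: "E \<noteq> {}"
    and flow_measurable:
      "case_prod \<Phi> \<in> borel_on E \<Otimes>\<^sub>M borel_on {0..} \<rightarrow>\<^sub>M borel_on (closure E)"
    and flow: "\<And>\<xi> t s. \<lbrakk>\<xi> \<in> E; 0 \<le> t; 0 \<le> s; \<Phi> \<xi> t \<in> E\<rbrakk> \<Longrightarrow> \<Phi> \<xi> (t + s) = \<Phi> (\<Phi> \<xi> t) s"
    and exit_time_measurable: "exit_time E \<Phi> \<in> borel_measurable (borel_on E)"
    and rate_measurable: "lam \<in> borel_measurable (borel_on (closure E))"
    and rate_nonneg: "\<And>\<xi>. \<xi> \<in> closure E \<Longrightarrow> 0 \<le> lam \<xi>"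
    and rate_locally_integrable:
      "\<And>\<xi>. \<xi> \<in> E \<Longrightarrow> \<exists>\<epsilon>>0. (\<integral>\<^sup>+ s \<in> {0..\<epsilon>}. ennreal (lam (\<Phi> \<xi> s)) \<partial>lborel) < \<infinity>"
    and kernel: "Q \<in> borel_on (closure E) \<rightarrow>\<^sub>M prob_algebra (borel_on (closure E))"
    and kernel_no_stay: "\<And>\<xi>. \<xi> \<in> closure E \<Longrightarrow> emeasure (Q \<xi>) (closure E - {\<xi>}) = 1"
    and kernel_E: "\<And>\<xi>. \<xi> \<in> closure E \<Longrightarrow> emeasure (Q \<xi>) E = 1"

definition history_of ::
  "'w measure \<Rightarrow> (nat \<Rightarrow> 'w \<Rightarrow> 'a::topological_space) \<Rightarrow> (nat \<Rightarrow> 'w \<Rightarrow> real) \<Rightarrow> nat \<Rightarrow> 'w measure" where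
  "history_of P Z S n =
     vimage_algebra (space P) (\<lambda>\<omega>. \<lambda>i\<in>{..n}. (Z i \<omega>, S i \<omega>)) (\<Pi>\<^sub>M i\<in>{..n}. borel \<Otimes>\<^sub>M borel)"

definition history_and_next_time ::
  "'w measure \<Rightarrow> (nat \<Rightarrow> 'w \<Rightarrow> 'a::topological_space) \<Rightarrow> (nat \<Rightarrow> 'w \<Rightarrow> real) \<Rightarrow> nat \<Rightarrow> 'w measure" where
  "history_and_next_time P Z S n =
     vimage_algebra (space P) (\<lambda>\<omega>. (\<lambda>i\<in>{..n}. (Z i \<omega>, S i \<omega>), S (Suc n) \<omega>))
       ((\<Pi>\<^sub>M i\<in>{..n}. borel \<Otimes>\<^sub>M borel) \<Otimes>\<^sub>M borel)"

definition endpoints :: "'w measure \<Rightarrow> (nat \<Rightarrow> 'w \<Rightarrow> 'a::topological_space) \<Rightarrow> nat \<Rightarrow> 'w measure" where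
  "endpoints P Z n = vimage_algebra (space P) (\<lambda>\<omega>. (Z n \<omega>, Z (Suc n) \<omega>)) (borel \<Otimes>\<^sub>M borel)"

text \<open>
  The embedded chain of the process: post-jump locations \<open>Z\<close> and interarrival times \<open>S\<close> on a
  probability space \<open>P\<close>, with \<open>\<nu>\<^sub>0\<close> the law of \<open>Z 0\<close>.
\<close>

locale pdmp_chain = pdmp E \<Phi> lam Q + prob_space P
  for E :: "'a::{metric_space, second_countable_topology} set"
    and \<Phi> :: "'a \<Rightarrow> real \<Rightarrow> 'a"
    and lam :: "'a \<Rightarrow> real"
    and Q :: "'a \<Rightarrow> 'a measure"
    and P :: "'w measure" +
  fixes \<nu>\<^sub>0 :: "'a measure"
    and Z :: "nat \<Rightarrow> 'w \<Rightarrow> 'a"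
    and S :: "nat \<Rightarrow> 'w \<Rightarrow> real"
  assumes Z_measurable: "\<And>n. Z n \<in> P \<rightarrow>\<^sub>M borel_on E"
    and S_measurable: "\<And>n. S n \<in> P \<rightarrow>\<^sub>M borel_on {0..}"
    and S_0: "\<And>\<omega>. \<omega> \<in> space P \<Longrightarrow> S 0 \<omega> = 0"
    and law_Z_0: "distr P (borel_on E) (Z 0) = \<nu>\<^sub>0"
    and law_S_Suc: "\<And>n t. 0 \<le> t \<Longrightarrow>
      AE \<omega> in P.
        real_cond_exp P (history_of P Z S n) (indicator {\<omega> \<in> space P. t < S (Suc n) \<omega>}) \<omega> =
        surv \<Phi> lam (Z n \<omega>) t * (if ereal t < exit_time E \<Phi> (Z n \<omega>) then 1 else 0)"
    and law_Z_Suc: "\<And>n B. \<lbrakk>B \<in> sets borel; B \<subseteq> E\<rbrakk> \<Longrightarrow>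
      AE \<omega> in P.
        real_cond_exp P (history_and_next_time P Z S n)
          (indicator {\<omega> \<in> space P. Z (Suc n) \<omega> \<in> B}) \<omega> =
        measure (kernel_along \<Phi> Q (Z n \<omega>) (S (Suc n) \<omega>)) B"

end

theory Submission
  imports Defs
begin

text \<open>
  Let \<open>T\<close> be the exit time. Given \<open>Z\<^sub>n = x\<close>, the interarrival time has density \<open>f(x, \<cdot>)\<close> on
  \<open>[0, T(x))\<close> and an atom of mass \<open>G(x, T(x))\<close> at \<open>T(x)\<close>, because \<open>G(x, \<cdot>)\<close> has derivative
  \<open>-f(x, \<cdot>)\<close>. By Tonelli, on the event \<open>S\<^sub>n\<^sub>+\<^sub>1 > t\<close> with \<open>t < T(x)\<close> the next location has the
  \<open>\<mu>\<close>-density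
  \<open>H(x, y, t) = \<integral>\<^sub>t\<^sup>T f(x, s) Qt(x, s, y) ds + G(x, T) Qt(x, T, y)\<close>,
  so the conditional probability is \<open>H(x, y, t) / H(x, y, 0)\<close>. Since \<open>cond_rate\<close> is minus the
  logarithmic derivative of \<open>H(x, y, \<cdot>)\<close>, this quotient is the exponential in the theorem.
\<close>

section \<open>Two tools: equality of measures on a product, and conditional probabilities as
  integral identities\<close>

lemma measure_eqI_rectangles:
  assumes "sets M = sets (A \<Otimes>\<^sub>M B)" "sets N = sets (A \<Otimes>\<^sub>M B)"
    and fin: "emeasure M (space M) \<noteq> \<infinity>"
    and eq: "\<And>a b. a \<in> sets A \<Longrightarrow> b \<in> sets B \<Longrightarrow> emeasure M (a \<times> b) = emeasure N (a \<times> b)"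
  shows "M = N"
proof (rule measure_eqI_generator_eq)
  let ?G = "{a \<times> b |a b. a \<in> sets A \<and> b \<in> sets B}"
  show "Int_stable ?G"
    by (rule Int_stable_pair_measure_generator)
  show "?G \<subseteq> Pow (space A \<times> space B)"
    by (rule pair_measure_closed)
  show "sets M = sigma_sets (space A \<times> space B) ?G" "sets N = sigma_sets (space A \<times> space B) ?G"
    by (simp_all only: assms(1,2) sets_pair_measure)
  show "emeasure M X = emeasure N X" if "X \<in> ?G" for X
    using that eq by blast
  \<comment> \<open>The whole space is itself a rectangle, so the constant sequence covers it, and
    finiteness of \<open>M\<close> alone gives the finiteness that the uniqueness theorem asks
    for.\<close>
  show "range (\<lambda>_::nat. space A \<times> space B) \<subseteq> ?G"
    by blast
  show "emeasure M (space A \<times> space B) \<noteq> \<infinity>"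
    using fin sets_eq_imp_space_eq[OF assms(1)] by (metis space_pair_measure)
qed simp

text \<open>This turns the almost-sure laws of the chain into identities between nonnegative
  integrals. Since \<open>g\<close> agrees almost everywhere with the conditional expectation, it
  inherits integrability and nonnegativity from there, and truncation by \<open>ennreal\<close>
  loses nothing.\<close>

lemma (in prob_space) emeasure_Int_of_cond_prob:
  assumes sub: "subalgebra M F" and A: "A \<in> sets M" and C: "C \<in> sets F"
    and g: "AE \<omega> in M. real_cond_exp M F (indicator A) \<omega> = g \<omega>"
  shows "emeasure M (A \<inter> C) = (\<integral>\<^sup>+\<omega>. ennreal (g \<omega>) * indicator C \<omega> \<partial>M)"
proof -
  interpret finite_measure_subalgebra M F
    by unfold_locales (rule sub)
  let ?r = "real_cond_exp M F (indicator A)"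
  have CM: "C \<in> sets M"
    using C sub by (auto simp: subalgebra_def)
  have int: "integrable M (indicator A :: _ \<Rightarrow> real)"
    using A by (simp add: less_top[symmetric])
  have pos: "AE \<omega> in M. 0 \<le> ?r \<omega>"
    using A by (intro real_cond_exp_pos) auto
  have "(\<integral>\<^sup>+\<omega>. ennreal (g \<omega>) * indicator C \<omega> \<partial>M) = (\<integral>\<^sup>+\<omega>. ennreal (indicator C \<omega> *\<^sub>R ?r \<omega>) \<partial>M)"
    using g by (intro nn_integral_cong_AE) (auto elim!: eventually_mono simp: indicator_def)
  also have "\<dots> = ennreal (\<integral>\<omega>. indicator C \<omega> *\<^sub>R ?r \<omega> \<partial>M)"
    using pos real_cond_exp_int(1)[OF int] CM
    by (intro nn_integral_eq_integral integrable_mult_indicator) auto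
  also have "(\<integral>\<omega>. indicator C \<omega> *\<^sub>R ?r \<omega> \<partial>M) = (\<integral>\<omega>. indicator C \<omega> *\<^sub>R indicator A \<omega> \<partial>M)"
    using real_cond_exp_intA[OF int C] by (simp add: set_lebesgue_integral_def)
  also have "\<dots> = measure M (A \<inter> C)"
    using A CM by (simp add: indicator_inter_arith[symmetric] Int_commute mult.commute)
  finally show ?thesis
    by (simp add: emeasure_eq_measure)
qed

section \<open>Exit time, jump rate and survival function along the flow\<close>

locale pdmp_density = pdmp E \<Phi> lam Q
  for E :: "'a::{metric_space, second_countable_topology} set"
    and \<Phi> :: "'a \<Rightarrow> real \<Rightarrow> 'a"
    and lam :: "'a \<Rightarrow> real"
    and Q :: "'a \<Rightarrow> 'a measure" +
  fixes \<mu> :: "'a measure"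
    and Qt :: "'a \<Rightarrow> real \<Rightarrow> 'a \<Rightarrow> real"
  assumes sets_\<mu>: "sets \<mu> = sets (borel_on E)"
    and Qt_measurable: "(\<lambda>(x, s, y). Qt x s y) \<in>
          borel_measurable (borel_on E \<Otimes>\<^sub>M borel_on {0..} \<Otimes>\<^sub>M borel_on E)"
    and kernel_density: "\<And>\<xi> s B. \<lbrakk>\<xi> \<in> E; 0 \<le> s; B \<in> sets borel; B \<subseteq> E\<rbrakk> \<Longrightarrow>
          emeasure (kernel_along \<Phi> Q \<xi> s) B = (\<integral>\<^sup>+ y \<in> B. ennreal (Qt \<xi> s y) \<partial>\<mu>)"
    and Qt_continuous: "\<And>x y. \<lbrakk>x \<in> E; y \<in> E\<rbrakk> \<Longrightarrow> continuous_on {0..} (\<lambda>s. Qt x s y)"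
    and Qt_bounded_below: "\<exists>m>0. \<forall>x\<in>E. \<forall>y\<in>E. \<forall>s\<ge>0. m \<le> Qt x s y"
    and dens_continuous: "\<And>\<xi>. \<xi> \<in> E \<Longrightarrow> continuous_on {0..} (dens \<Phi> lam \<xi>)"
    and rate_dominated: "\<exists>M :: real \<Rightarrow> real. (\<forall>T\<ge>0. set_integrable lborel {0..T} M) \<and>
          (\<forall>\<xi>\<in>E. \<forall>t\<ge>0. rate_along \<Phi> lam \<xi> t \<le> M t)"
    and exit_time_bounded: "\<exists>T :: real. \<forall>\<xi>\<in>E. exit_time E \<Phi> \<xi> \<le> ereal T"
begin

abbreviation rate where "rate \<equiv> rate_along \<Phi> lam"
abbreviation G where "G \<equiv> surv \<Phi> lam"
abbreviation f where "f \<equiv> dens \<Phi> lam"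

definition T :: "'a \<Rightarrow> real" where "T x = real_of_ereal (exit_time E \<Phi> x)"

lemma exit_time_nonneg: "0 \<le> exit_time E \<Phi> x"
  unfolding exit_time_def by (intro Inf_greatest) auto

text \<open>The uniform bound on exit times excludes the infinite value, which
  \<open>real_of_ereal\<close> would send to 0.\<close>

lemma exit_time_eq: "x \<in> E \<Longrightarrow> exit_time E \<Phi> x = ereal (T x)"
  using exit_time_bounded exit_time_nonneg[of x] unfolding T_def
  by (cases "exit_time E \<Phi> x") auto

lemma T_nonneg: "0 \<le> T x"
  unfolding T_def using exit_time_nonneg by (rule real_of_ereal_pos)

lemma flow_in_closure: "x \<in> E \<Longrightarrow> 0 \<le> s \<Longrightarrow> \<Phi> x s \<in> closure E"
  using measurable_space[OF flow_measurable, of "(x, s)"]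
  by (auto simp: space_pair_measure space_restrict_space)

lemma rate_nonneg': "x \<in> E \<Longrightarrow> 0 \<le> s \<Longrightarrow> 0 \<le> rate x s"
  unfolding rate_along_def using flow_in_closure rate_nonneg by blast

lemma Qt_pos: "x \<in> E \<Longrightarrow> y \<in> E \<Longrightarrow> 0 \<le> s \<Longrightarrow> 0 < Qt x s y"
  using Qt_bounded_below by force

lemma G_pos: "0 < G x t"
  by (simp add: surv_def)

lemma f_nonneg: "x \<in> E \<Longrightarrow> 0 \<le> s \<Longrightarrow> 0 \<le> f x s"
  unfolding dens_def using rate_nonneg' G_pos by (simp add: less_imp_le)

lemma T_measurable [measurable]: "T \<in> borel_measurable (borel_on E)"
  unfolding T_def using exit_time_measurable by measurable

lemma rate_measurable_pair:
  "(\<lambda>(x, s). rate x s) \<in> borel_measurable (borel_on E \<Otimes>\<^sub>M borel_on {0..})"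
  using measurable_compose[OF flow_measurable rate_measurable]
  by (simp add: rate_along_def case_prod_beta)

text \<open>The flow and the rate are controlled at nonnegative times only. Composition with
  \<open>max 0\<close> extends functions of time to the whole line, where measurability and Lebesgue
  integration are available.\<close>

lemma max_0_measurable [measurable]: "max (0::real) \<in> borel \<rightarrow>\<^sub>M borel_on {0..}"
  by (auto intro!: measurable_restrict_space2)

lemma rate_measurable_ext [measurable]:
  "(\<lambda>(x, s). rate x (max 0 s)) \<in> borel_measurable (borel_on E \<Otimes>\<^sub>M borel)"
  using measurable_compose[OF _ rate_measurable_pair,
      of "\<lambda>(x, s). (x, max 0 s)" "borel_on E \<Otimes>\<^sub>M borel"]
  by (auto simp: case_prod_beta)

lemma G_eq: "G x t = exp (- (\<integral>s. indicator {0..t} s * rate x (max 0 s) \<partial>lborel))"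
  unfolding surv_def set_lebesgue_integral_def
  by (auto intro!: Bochner_Integration.integral_cong simp: indicator_def)

lemma G_measurable [measurable]: "(\<lambda>(x, t). G x t) \<in> borel_measurable (borel_on E \<Otimes>\<^sub>M borel)"
proof -
  let ?M = "(borel_on E \<Otimes>\<^sub>M borel) \<Otimes>\<^sub>M (borel :: real measure)"
  have [measurable]: "Measurable.pred ?M (\<lambda>p. 0 \<le> snd p)"
    unfolding pred_def by (intro borel_measurable_le) simp_all
  have [measurable]: "Measurable.pred ?M (\<lambda>p. snd p \<le> snd (fst p))"
    unfolding pred_def by (intro borel_measurable_le) simp_all
  have [measurable]: "(\<lambda>p. rate (fst (fst p)) (max 0 (snd p))) \<in> borel_measurable ?M"
    by measurable
  \<comment> \<open>The upper limit of integration is part of the parameter, so the indicator has to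
    be measurable in all variables jointly; as a condition on the triple it is.\<close>
  have "(\<lambda>p. if 0 \<le> snd p \<and> snd p \<le> snd (fst p) then rate (fst (fst p)) (max 0 (snd p)) else 0)
      \<in> borel_measurable ?M"
    by measurable
  then have "(\<lambda>p. indicator {0..snd (fst p)} (snd p) * rate (fst (fst p)) (max 0 (snd p)))
      \<in> borel_measurable ((borel_on E \<Otimes>\<^sub>M borel) \<Otimes>\<^sub>M lborel)"
    by (subst measurable_cong_sets[OF sets_pair_measure_cong[OF refl sets_lborel] refl])
      (simp add: indicator_def if_distrib[of "\<lambda>c. c * _"] cong: if_cong)
  then have "(\<lambda>p. \<integral>s. indicator {0..snd p} s * rate (fst p) (max 0 s) \<partial>lborel)
      \<in> borel_measurable (borel_on E \<Otimes>\<^sub>M borel)"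
    by (intro lborel.borel_measurable_lebesgue_integral) (simp add: case_prod_beta)
  then show ?thesis
    unfolding G_eq case_prod_beta by measurable
qed

lemma f_measurable_ext [measurable]:
  "(\<lambda>(x, s). f x (max 0 s)) \<in> borel_measurable (borel_on E \<Otimes>\<^sub>M borel)"
  unfolding dens_def by measurable

text \<open>The locally integrable majorant makes the integral in \<open>surv\<close> a genuine one,
  never the default value 0.\<close>

lemma rate_integrable:
  assumes "x \<in> E"
  shows "set_integrable lborel {0..t} (rate x)"
proof (cases "0 \<le> t")
  case True
  obtain M where M: "set_integrable lborel {0..t} M" "\<And>s. 0 \<le> s \<Longrightarrow> rate x s \<le> M s"
    using rate_dominated assms True by metis
  have "(\<lambda>s. rate x (max 0 s)) \<in> borel_measurable borel"
    using measurable_compose[OF measurable_Pair1' rate_measurable_ext, of x] assms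
    by (simp add: space_restrict_space)
  then have *: "(\<lambda>s. indicator {0..t} s *\<^sub>R rate x (max 0 s)) \<in> borel_measurable lborel"
    by simp
  have **: "(\<lambda>s. indicator {0..t} s *\<^sub>R rate x s) = (\<lambda>s. indicator {0..t} s *\<^sub>R rate x (max 0 s))"
    by (auto simp: indicator_def fun_eq_iff)
  show ?thesis
    unfolding set_integrable_def
  proof (rule Bochner_Integration.integrable_bound[OF M(1)[unfolded set_integrable_def]])
    show "(\<lambda>s. indicator {0..t} s *\<^sub>R rate x s) \<in> borel_measurable lborel"
      using * ** by simp
    show "AE s in lborel. norm (indicator {0..t} s *\<^sub>R rate x s) \<le> norm (indicator {0..t} s *\<^sub>R M s)"
    proof (rule AE_I2)
      fix s
      show "norm (indicator {0..t} s *\<^sub>R rate x s) \<le> norm (indicator {0..t} s *\<^sub>R M s)"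
      proof (cases "s \<in> {0..t}")
        case True
        then show ?thesis
          using M(2)[of s] rate_nonneg'[OF assms, of s] by simp
      qed simp
    qed
  qed
qed (simp add: set_integrable_def)

lemma G_continuous:
  assumes "x \<in> E"
  shows "continuous_on {0..b} (G x)"
proof -
  have "rate x integrable_on {0..b}"
    using rate_integrable[OF assms] by (rule set_borel_integral_eq_integral)
  then have "continuous_on {0..b} (\<lambda>t. integral {0..t} (rate x))"
    by (rule indefinite_integral_continuous_1)
  then show ?thesis
    unfolding surv_def
    by (simp add: set_borel_integral_eq_integral(2)[OF rate_integrable[OF assms]] continuous_intros)
qed

text \<open>Continuity is assumed for \<open>f x\<close> and not for the rate. But the rate is the
  quotient of \<open>f x\<close> by the continuous positive function \<open>G x\<close>, hence
  continuous at nonnegative times, so the fundamental theorem applies at every point.\<close>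

lemma G_derivative:
  assumes x: "x \<in> E" and t: "0 \<le> t" "t \<le> b"
  shows "(G x has_real_derivative - f x t) (at t within {0..b})"
proof -
  have "continuous_on {0..b} (\<lambda>s. f x s / G x s)"
    using G_continuous[OF x] G_pos[of x]
    by (intro continuous_on_divide continuous_on_subset[OF dens_continuous[OF x]])
      (auto simp: less_imp_neq[symmetric])
  then have "continuous_on {0..b} (rate x)"
    using G_pos[of x] by (simp add: dens_def less_imp_neq[symmetric])
  then have "((\<lambda>t. integral {0..t} (rate x)) has_real_derivative rate x t) (at t within {0..b})"
    using t by (intro integral_has_real_derivative) auto
  then show ?thesis
    unfolding surv_def dens_def
    by (auto simp: set_borel_integral_eq_integral(2)[OF rate_integrable[OF x]]
        intro!: derivative_eq_intros)
qed

lemma G_0: "G x 0 = 1"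
proof -
  have "(\<integral>s. indicator {0..0} s *\<^sub>R rate x s \<partial>lborel) = 0"
    using AE_lborel_singleton[of "0::real"]
    by (intro integral_eq_zero_AE) (auto elim!: eventually_mono)
  then show ?thesis
    by (simp add: surv_def set_lebesgue_integral_def)
qed

lemma continuous_f_mult:
  assumes "x \<in> E" "continuous_on {0..} g" "0 \<le> a"
  shows "continuous_on {a..b} (\<lambda>s. f x s * g s)"
  using assms by (intro continuous_on_mult continuous_on_subset[OF dens_continuous]
      continuous_on_subset[OF assms(2)]) auto

lemma f_integral:
  assumes x: "x \<in> E" and t: "0 \<le> t" "t \<le> b"
  shows "(LBINT s:{t..b}. f x s) = G x t - G x b"
proof -
  have "((\<lambda>s. - G x s) has_vector_derivative f x s) (at s within {t..b})" if "t \<le> s" "s \<le> b" for s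
    using DERIV_minus[OF DERIV_subset[OF G_derivative[OF x, of s b]]] t that
    by (auto simp: has_real_derivative_iff_has_vector_derivative)
  then have "(f x has_integral - G x b - - G x t) {t..b}"
    using t by (intro fundamental_theorem_of_calculus) auto
  moreover have "set_integrable lborel {t..b} (f x)"
    using continuous_f_mult[OF x, of "\<lambda>_. 1" t b] t by (intro borel_integrable_atLeastAtMost') simp
  ultimately show ?thesis
    by (simp add: set_borel_integral_eq_integral(2) integral_unique)
qed

section \<open>The law of one interarrival time as a Lebesgue density\<close>

text \<open>
  Under the density \<open>w x\<close> with respect to Lebesgue measure, \<open>jump x\<close> has the law of the
  interarrival time from \<open>x\<close>: the interval \<open>[T x, T x + 1]\<close> of length one carries the mass of
  the atom at \<open>T x\<close>.
\<close>

definition w :: "'a \<Rightarrow> real \<Rightarrow> real" where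
  "w x u = (if 0 \<le> u \<and> u < T x then f x u else if T x \<le> u \<and> u \<le> T x + 1 then G x (T x) else 0)"

definition jump :: "'a \<Rightarrow> real \<Rightarrow> real" where
  "jump x u = max 0 (min u (T x))"

lemma w_measurable [measurable]: "(\<lambda>(x, u). w x u) \<in> borel_measurable (borel_on E \<Otimes>\<^sub>M borel)"
proof -
  have "(\<lambda>(x, u). if 0 \<le> u \<and> u < T x then f x (max 0 u)
      else if T x \<le> u \<and> u \<le> T x + 1 then G x (T x) else 0) \<in> borel_measurable (borel_on E \<Otimes>\<^sub>M borel)"
    by measurable
  also have "(\<lambda>(x, u). if 0 \<le> u \<and> u < T x then f x (max 0 u)
      else if T x \<le> u \<and> u \<le> T x + 1 then G x (T x) else 0) = (\<lambda>(x, u). w x u)"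
    by (auto simp: w_def fun_eq_iff)
  finally show ?thesis .
qed

lemma jump_measurable [measurable]:
  "(\<lambda>(x, u). jump x u) \<in> borel_on E \<Otimes>\<^sub>M borel \<rightarrow>\<^sub>M borel_on {0..}"
  unfolding jump_def by measurable

text \<open>Below \<open>T x\<close> the map \<open>jump x\<close> is the identity, which yields the
  integral against \<open>f x\<close>; on the interval of length one above \<open>T x\<close> it is
  constant, which yields the atom term. The lower limit is \<open>max 0 t\<close> because no mass of
  \<open>w x\<close> lies below 0.\<close>

lemma nn_integral_w:
  assumes x: "x \<in> E" and g: "continuous_on {0..} g" "\<And>s. 0 \<le> s \<Longrightarrow> 0 \<le> g s"
  shows "(\<integral>\<^sup>+u. ennreal (w x u) * indicator {t<..} (jump x u) * ennreal (g (jump x u)) \<partial>lborel) =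
    (if t < T x then ennreal ((LBINT s:{max 0 t..T x}. f x s * g s) + G x (T x) * g (T x)) else 0)"
proof (cases "t < T x")
  case True
  let ?a = "max 0 t"
  have int: "set_integrable lborel {?a..T x} (\<lambda>s. f x s * g s)"
    using continuous_f_mult[OF x g(1)] by (intro borel_integrable_atLeastAtMost') simp
  have nn: "0 \<le> f x s * g s" if "?a \<le> s" for s
    using f_nonneg[OF x] g(2) that by simp
  have "(\<integral>\<^sup>+u. ennreal (w x u) * indicator {t<..} (jump x u) * ennreal (g (jump x u)) \<partial>lborel)
    = (\<integral>\<^sup>+u. ennreal (indicator {?a..T x} u *\<^sub>R (f x u * g u))
        + ennreal (G x (T x) * g (T x)) * indicator {T x..T x + 1} u \<partial>lborel)"
    \<comment> \<open>The two integrands may differ at \<open>max 0 t\<close>, where the strict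
      inequality fails, and at \<open>T x\<close>, where the closed intervals overlap; both points
      are null.\<close>
    using AE_lborel_singleton[of ?a] AE_lborel_singleton[of "T x"]
    by (intro nn_integral_cong_AE, eventually_elim)
      (use T_nonneg[of x] True f_nonneg[OF x] G_pos[of x] in
        \<open>auto simp: w_def jump_def indicator_def ennreal_mult' less_imp_le max_def min_def split: if_splits\<close>)
  also have "\<dots> = (\<integral>\<^sup>+u. ennreal (indicator {?a..T x} u *\<^sub>R (f x u * g u)) \<partial>lborel)
      + (\<integral>\<^sup>+u. ennreal (G x (T x) * g (T x)) * indicator {T x..T x + 1} u \<partial>lborel)"
    using int by (intro nn_integral_add) (auto simp: set_integrable_def)
  also have "(\<integral>\<^sup>+u. ennreal (indicator {?a..T x} u *\<^sub>R (f x u * g u)) \<partial>lborel)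
      = ennreal (LBINT s:{?a..T x}. f x s * g s)"
    unfolding set_lebesgue_integral_def using int nn
    by (intro nn_integral_eq_integral) (auto simp: set_integrable_def indicator_def)
  also have "(\<integral>\<^sup>+u. ennreal (G x (T x) * g (T x)) * indicator {T x..T x + 1} u \<partial>lborel)
      = ennreal (G x (T x) * g (T x))"
    by (simp add: nn_integral_cmult)
  also have "ennreal (LBINT s:{?a..T x}. f x s * g s) + ennreal (G x (T x) * g (T x))
      = ennreal ((LBINT s:{?a..T x}. f x s * g s) + G x (T x) * g (T x))"
    using nn g(2)[OF T_nonneg] G_pos[of x "T x"]
    by (intro ennreal_plus[symmetric]) 
       (auto simp: set_lebesgue_integral_def indicator_def less_imp_le intro!: Bochner_Integration.integral_nonneg)
  finally show ?thesis
    using True by simp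
next
  case False
  then have "indicator {t<..} (jump x u) = (0::ennreal)" for u
    using T_nonneg[of x] by (auto simp: jump_def indicator_def)
  then show ?thesis
    using False by simp
qed

text \<open>With \<open>g = 1\<close> the integral of \<open>f x\<close> is
  \<open>G x (max 0 t) - G x (T x)\<close>, and the atom cancels the subtracted term. What remains
  is the conditional tail prescribed by \<open>law_S_Suc\<close>.\<close>

lemma nn_integral_w_1:
  assumes x: "x \<in> E"
  shows "(\<integral>\<^sup>+u. ennreal (w x u) * indicator {t<..} (jump x u) \<partial>lborel) =
    (if t < T x then ennreal (G x (max 0 t)) else 0)"
  using nn_integral_w[OF x, of "\<lambda>_. 1" t] f_integral[OF x, of "max 0 t" "T x"] T_nonneg[of x]
  by (auto split: if_splits)

section \<open>The function \<open>H\<close> and the exponential of the integrated conditional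
  rate\<close>

definition H :: "'a \<Rightarrow> 'a \<Rightarrow> real \<Rightarrow> real" where
  "H x y t = (LBINT s:{t..T x}. f x s * Qt x s y) + G x (T x) * Qt x (T x) y"

text \<open>The atom term is strictly positive, while the integral is only nonnegative and vanishes
  at \<open>t = T x\<close>. Positivity justifies the quotients and logarithms below.\<close>

lemma H_pos:
  assumes "x \<in> E" "y \<in> E" "0 \<le> t"
  shows "0 < H x y t"
proof -
  have "0 \<le> (LBINT s:{t..T x}. f x s * Qt x s y)"
    using f_nonneg[OF assms(1)] Qt_pos[OF assms(1,2)] assms(3)
    by (auto simp: set_lebesgue_integral_def indicator_def less_imp_le intro!: Bochner_Integration.integral_nonneg)
  then show ?thesis
    unfolding H_def using G_pos Qt_pos[OF assms(1,2) T_nonneg]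
    by (simp add: add_nonneg_pos)
qed

lemma H_derivative:
  assumes "x \<in> E" "y \<in> E" and t: "0 \<le> t" "t \<le> T x"
  shows "(H x y has_real_derivative - (f x t * Qt x t y)) (at t within {0..T x})"
proof -
  let ?g = "\<lambda>s. f x s * Qt x s y"
  have c: "continuous_on {a..T x} ?g" if "0 \<le> a" for a
    using that by (intro continuous_f_mult Qt_continuous assms)
  have "((\<lambda>u. integral {u..T x} ?g) has_real_derivative - ?g t) (at t within {0..T x})"
    using c[of 0] t by (intro integral_has_real_derivative') auto
  then have "((\<lambda>u. integral {u..T x} ?g + G x (T x) * Qt x (T x) y) has_real_derivative - ?g t)
      (at t within {0..T x})"
    by (auto intro!: derivative_eq_intros)
  moreover have "integral {u..T x} ?g = (LBINT s:{u..T x}. ?g s)" if "0 \<le> u" for u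
    using borel_integrable_atLeastAtMost'[OF c[OF that]] by (simp add: set_borel_integral_eq_integral(2))
  ultimately show ?thesis
    unfolding H_def
    \<comment> \<open>The radius 1 is arbitrary: gauge and Lebesgue integrals agree at all points of
      the interval.\<close>
    by (elim has_field_derivative_transform_within[of _ _ _ _ 1]) (use t in auto)
qed

lemma exp_cond_rate:
  assumes "x \<in> E" "y \<in> E" and t: "0 \<le> t" "t \<le> T x"
  shows "exp (- (LBINT s:{0..t}. cond_rate E \<Phi> lam Qt x y s)) = H x y t / H x y 0"
proof -
  let ?r = "cond_rate E \<Phi> lam Qt x y"
  have r: "?r s = f x s * Qt x s y / H x y s" for s
    by (simp add: cond_rate_def H_def T_def Let_def)
  have "continuous_on {0..T x} (H x y)"
    using H_derivative[OF assms(1,2)] by (intro DERIV_continuous_on) auto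
  \<comment> \<open>Continuity on a compact interval makes the rate Lebesgue integrable, so the
    gauge integral from the fundamental theorem is also the Lebesgue integral.\<close>
  then have "continuous_on {0..t} ?r"
    unfolding r using t H_pos[OF assms(1,2)]
    by (intro continuous_on_divide continuous_f_mult Qt_continuous assms)
      (auto intro: continuous_on_subset simp: less_imp_neq[symmetric])
  then have int: "set_integrable lborel {0..t} ?r"
    by (rule borel_integrable_atLeastAtMost')
  have "((\<lambda>s. - ln (H x y s)) has_vector_derivative ?r s) (at s within {0..t})"
    if "0 \<le> s" "s \<le> t" for s
    using DERIV_subset[OF H_derivative[OF assms(1,2), of s], of "{0..t}"] H_pos[OF assms(1,2), of s] t that
    unfolding has_real_derivative_iff_has_vector_derivative[symmetric] r
    by (auto intro!: derivative_eq_intros)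
  then have "(?r has_integral (- ln (H x y t) - - ln (H x y 0))) {0..t}"
    using t by (intro fundamental_theorem_of_calculus) auto
  then have "(LBINT s:{0..t}. ?r s) = ln (H x y 0) - ln (H x y t)"
    using int by (simp add: set_borel_integral_eq_integral(2) integral_unique)
  then show ?thesis
    using H_pos[OF assms(1,2)] t by (simp add: exp_diff)
qed

section \<open>The density of the next location\<close>

lemma space_\<mu>: "space \<mu> = E"
  using sets_eq_imp_space_eq[OF sets_\<mu>] by (simp add: space_restrict_space)

lemma sets_borel_on: "B \<in> sets (borel_on E) \<longleftrightarrow> B \<in> sets borel \<and> B \<subseteq> E"
  using open_E by (subst sets_restrict_space_iff) auto

lemma prob_kernel_along:
  assumes "x \<in> E" "0 \<le> s"
  shows "prob_space (kernel_along \<Phi> Q x s)"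
  using measurable_space[OF kernel, of "\<Phi> x s"] flow_in_closure[OF assms]
  by (simp add: kernel_along_def space_prob_algebra space_restrict_space)

text \<open>The lower bound \<open>m\<close> on the density gives
  \<open>m * \<mu>(E) \<le> Q(E) = 1\<close>. Finiteness of \<mu> is what allows the order of
  integration to be exchanged later.\<close>

lemma finite_measure_\<mu>: "finite_measure \<mu>"
proof
  obtain m x where m: "0 < m" "\<And>x y s. x \<in> E \<Longrightarrow> y \<in> E \<Longrightarrow> 0 \<le> s \<Longrightarrow> m \<le> Qt x s y" and x: "x \<in> E"
    using Qt_bounded_below nonempty_E by blast
  have E: "E \<in> sets \<mu>"
    using open_E by (simp add: sets_\<mu> sets_borel_on)
  have "ennreal m * emeasure \<mu> E = (\<integral>\<^sup>+y\<in>E. ennreal m \<partial>\<mu>)"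
    using E by (simp add: nn_integral_cmult_indicator)
  also have "\<dots> \<le> (\<integral>\<^sup>+y\<in>E. ennreal (Qt x 0 y) \<partial>\<mu>)"
    using m(2) x by (intro nn_integral_mono) (auto simp: indicator_def intro: ennreal_leI)
  also have "\<dots> = 1"
    using kernel_density[OF x, of 0 E] kernel_E[OF flow_in_closure[OF x, of 0]] open_E
    by (simp add: kernel_along_def)
  finally show "emeasure \<mu> (space \<mu>) \<noteq> \<infinity>"
    using m(1) by (auto simp: space_\<mu> ennreal_mult_top top_unique)
qed

sublocale \<mu>: finite_measure \<mu>
  by (rule finite_measure_\<mu>)

lemma jump_nonneg: "0 \<le> jump x u"
  by (simp add: jump_def)

lemma jump_borel [measurable]: "(\<lambda>(x, u). jump x u) \<in> borel_measurable (borel_on E \<Otimes>\<^sub>M borel)"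
  using jump_measurable by (simp add: measurable_restrict_space2_iff)

text \<open>\<open>Qt\<close> is measurable on nonnegative times only; \<open>jump\<close> always
  produces such a time, whatever real number it is given.\<close>

lemma Qt_jump_measurable [measurable (raw)]:
  assumes [measurable]: "a \<in> N \<rightarrow>\<^sub>M borel_on E" "b \<in> borel_measurable N" "c \<in> N \<rightarrow>\<^sub>M borel_on E"
  shows "(\<lambda>z. Qt (a z) (jump (a z) (b z)) (c z)) \<in> borel_measurable N"
proof -
  have "(\<lambda>z. (a z, jump (a z) (b z), c z)) \<in> N \<rightarrow>\<^sub>M borel_on E \<Otimes>\<^sub>M borel_on {0..} \<Otimes>\<^sub>M borel_on E"
    using measurable_compose[OF _ jump_measurable, of "\<lambda>z. (a z, b z)" N] by simp
  from measurable_compose[OF this Qt_measurable] show ?thesis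
    by simp
qed

text \<open>
  The density of the next location on the event that the jump occurs after time \<open>t\<close>. Jump times
  are nonnegative, so \<open>h (-1)\<close> is the density without any restriction.
\<close>

definition h :: "real \<Rightarrow> 'a \<Rightarrow> 'a \<Rightarrow> ennreal" where
  "h t x y = (\<integral>\<^sup>+u. ennreal (w x u) * indicator {t<..} (jump x u) * ennreal (Qt x (jump x u) y) \<partial>lborel)"

lemma h_eq:
  "x \<in> E \<Longrightarrow> y \<in> E \<Longrightarrow> h t x y = (if t < T x then ennreal (H x y (max 0 t)) else 0)"
  unfolding h_def H_def using Qt_pos by (intro nn_integral_w Qt_continuous) (auto simp: less_imp_le)

lemma h_measurable [measurable]:
  "(\<lambda>(x, y). h t x y) \<in> borel_measurable (borel_on E \<Otimes>\<^sub>M borel_on E)"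
  unfolding h_def by measurable

text \<open>The kernel is replaced by its density at the nonnegative time \<open>jump x u\<close>,
  and Tonelli moves the integral over \<open>u\<close> inside, where it is \<open>h t x y\<close> by
  definition.\<close>

lemma nn_integral_w_kernel:
  assumes x: "x \<in> E" and B: "B \<in> sets (borel_on E)"
  shows "(\<integral>\<^sup>+u. ennreal (w x u) * indicator {t<..} (jump x u) *
      emeasure (kernel_along \<Phi> Q x (jump x u)) B \<partial>lborel) = (\<integral>\<^sup>+y\<in>B. h t x y \<partial>\<mu>)"
proof -
  interpret pair_sigma_finite lborel \<mu> ..
  have [measurable]: "x \<in> space (borel_on E)" "B \<in> sets (borel_on E)"
    using x B by (auto simp: space_restrict_space)
  have [measurable_cong]: "sets \<mu> = sets (borel_on E)"
    by (rule sets_\<mu>)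
  have "(\<integral>\<^sup>+u. ennreal (w x u) * indicator {t<..} (jump x u) *
      emeasure (kernel_along \<Phi> Q x (jump x u)) B \<partial>lborel)
    = (\<integral>\<^sup>+u. \<integral>\<^sup>+y. ennreal (w x u) * indicator {t<..} (jump x u) *
      (ennreal (Qt x (jump x u) y) * indicator B y) \<partial>\<mu> \<partial>lborel)"
  proof (intro nn_integral_cong)
    fix u
    have "(\<lambda>y. ennreal (Qt x (jump x u) y) * indicator B y) \<in> borel_measurable \<mu>"
      by measurable
    then show "ennreal (w x u) * indicator {t<..} (jump x u) * emeasure (kernel_along \<Phi> Q x (jump x u)) B
      = (\<integral>\<^sup>+y. ennreal (w x u) * indicator {t<..} (jump x u) *
          (ennreal (Qt x (jump x u) y) * indicator B y) \<partial>\<mu>)"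
      using B x by (simp add: kernel_density sets_borel_on jump_nonneg nn_integral_cmult)
  qed
  also have "\<dots> = (\<integral>\<^sup>+y. \<integral>\<^sup>+u. ennreal (w x u) * indicator {t<..} (jump x u) *
      (ennreal (Qt x (jump x u) y) * indicator B y) \<partial>lborel \<partial>\<mu>)"
    by (intro Fubini'[symmetric]) measurable
  also have "\<dots> = (\<integral>\<^sup>+y\<in>B. h t x y \<partial>\<mu>)"
    unfolding h_def
  proof (intro nn_integral_cong)
    fix y assume "y \<in> space \<mu>"
    then have [measurable]: "y \<in> space (borel_on E)"
      by (simp add: space_\<mu> space_restrict_space)
    have "(\<lambda>u. ennreal (w x u) * indicator {t<..} (jump x u) * ennreal (Qt x (jump x u) y))
        \<in> borel_measurable lborel"
      by measurable
    then show "(\<integral>\<^sup>+u. ennreal (w x u) * indicator {t<..} (jump x u) *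
        (ennreal (Qt x (jump x u) y) * indicator B y) \<partial>lborel)
      = (\<integral>\<^sup>+u. ennreal (w x u) * indicator {t<..} (jump x u) * ennreal (Qt x (jump x u) y) \<partial>lborel) *
        indicator B y"
      by (subst nn_integral_multc[symmetric]) (simp_all add: mult.assoc)
  qed
  finally show ?thesis .
qed

end

section \<open>Joint laws of two consecutive locations and the time between them\<close>

locale pdmp_density_chain = pdmp_chain E \<Phi> lam Q P \<nu>\<^sub>0 Z S + pdmp_density E \<Phi> lam Q \<mu> Qt
  for E :: "'a::{metric_space, second_countable_topology} set"
    and \<Phi> lam Q and P :: "'w measure" and \<nu>\<^sub>0 Z S \<mu> Qt +
  fixes n :: nat
begin

abbreviation X where "X \<equiv> Z n"
abbreviation Y where "Y \<equiv> Z (Suc n)"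
abbreviation R where "R \<equiv> S (Suc n)"

lemma Z_in_E: "\<omega> \<in> space P \<Longrightarrow> Z i \<omega> \<in> E"
  using measurable_space[OF Z_measurable] by (simp add: space_restrict_space)

lemma S_nonneg: "\<omega> \<in> space P \<Longrightarrow> 0 \<le> S i \<omega>"
  using measurable_space[OF S_measurable] by (simp add: space_restrict_space)

lemma Z_measurable' [measurable]: "Z i \<in> P \<rightarrow>\<^sub>M borel_on E"
  by (rule Z_measurable)

lemma S_borel [measurable]: "S i \<in> borel_measurable P"
  using S_measurable by (simp add: measurable_restrict_space2_iff)

lemma Z_borel: "Z i \<in> borel_measurable P"
  using Z_measurable by (simp add: measurable_restrict_space2_iff)

lemma past_measurable: "(\<lambda>\<omega>. \<lambda>i\<in>{..k}. (Z i \<omega>, S i \<omega>)) \<in> P \<rightarrow>\<^sub>M (\<Pi>\<^sub>M i\<in>{..k}. borel \<Otimes>\<^sub>M borel)"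
  using Z_borel S_borel by (intro measurable_restrict measurable_Pair) auto

lemma subalgebra_vimage:
  assumes g: "g \<in> P \<rightarrow>\<^sub>M N"
  shows "subalgebra P (vimage_algebra (space P) g N)"
proof -
  have "g \<in> space P \<rightarrow> space N"
    using g by (auto dest: measurable_space)
  then show ?thesis
    using measurable_sets[OF g] by (auto simp: subalgebra_def sets_vimage_algebra2)
qed

text \<open>The event depends only on component \<open>n\<close> of the recorded tuple, so it is the
  preimage of a cylinder set. It serves as the conditioning event for
  \<open>law_S_Suc\<close>.\<close>

lemma history_of_X:
  assumes "A \<in> sets borel"
  shows "{\<omega> \<in> space P. X \<omega> \<in> A} \<in> sets (history_of P Z S n)"
proof -
  let ?N = "\<Pi>\<^sub>M i\<in>{..n}. borel \<Otimes>\<^sub>M borel :: ('a \<times> real) measure"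
  let ?p = "\<lambda>\<omega>. \<lambda>i\<in>{..n}. (Z i \<omega>, S i \<omega>)"
  have "(\<lambda>v. v n) \<in> ?N \<rightarrow>\<^sub>M borel \<Otimes>\<^sub>M borel"
    by (rule measurable_component_singleton) simp
  then have "(\<lambda>v. fst (v n)) \<in> borel_measurable ?N"
    by (rule measurable_compose) (rule measurable_fst)
  then have "?p -` {v \<in> space ?N. fst (v n) \<in> A} \<inter> space P \<in> sets (history_of P Z S n)"
    unfolding history_of_def using assms by (intro in_vimage_algebra) (simp add: measurable_sets_Collect)
  also have "?p -` {v \<in> space ?N. fst (v n) \<in> A} \<inter> space P = {\<omega> \<in> space P. X \<omega> \<in> A}"
    using measurable_space[OF past_measurable] by auto
  finally show ?thesis .
qed

text \<open>The analogous conditioning event for \<open>law_Z_Suc\<close>; here the bound on the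
  next time may be included, since that time belongs to the conditioning data.\<close>

lemma history_and_next_time_X_R:
  assumes "A \<in> sets borel"
  shows "{\<omega> \<in> space P. X \<omega> \<in> A \<and> t < R \<omega>} \<in> sets (history_and_next_time P Z S n)"
proof -
  let ?N = "(\<Pi>\<^sub>M i\<in>{..n}. borel \<Otimes>\<^sub>M borel) \<Otimes>\<^sub>M borel :: ((nat \<Rightarrow> 'a \<times> real) \<times> real) measure"
  let ?p = "\<lambda>\<omega>. (\<lambda>i\<in>{..n}. (Z i \<omega>, S i \<omega>), R \<omega>)"
  have "(\<lambda>v. v n) \<in> (\<Pi>\<^sub>M i\<in>{..n}. borel \<Otimes>\<^sub>M borel) \<rightarrow>\<^sub>M (borel \<Otimes>\<^sub>M borel :: ('a \<times> real) measure)"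
    by (rule measurable_component_singleton) simp
  from measurable_compose[OF measurable_compose[OF measurable_fst this] measurable_fst]
  have "(\<lambda>v. fst (fst v n)) \<in> borel_measurable ?N" .
  then have "{v \<in> space ?N. fst (fst v n) \<in> A} \<in> sets ?N"
    by (rule measurable_sets_Collect[where P = "\<lambda>x. x \<in> A"]) (simp add: assms)
  moreover have "{v \<in> space ?N. t < snd v} \<in> sets ?N"
    by measurable
  ultimately have "{v \<in> space ?N. fst (fst v n) \<in> A \<and> t < snd v} \<in> sets ?N"
    by (intro sets.sets_Collect_conj)
  then have "?p -` {v \<in> space ?N. fst (fst v n) \<in> A \<and> t < snd v} \<inter> space P
      \<in> sets (history_and_next_time P Z S n)"
    unfolding history_and_next_time_def by (rule in_vimage_algebra)
  also have "?p -` {v \<in> space ?N. fst (fst v n) \<in> A \<and> t < snd v} \<inter> space P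
      = {\<omega> \<in> space P. X \<omega> \<in> A \<and> t < R \<omega>}"
    using measurable_space[OF past_measurable] by (auto simp: space_pair_measure)
  finally show ?thesis .
qed

text \<open>For \<open>t \<ge> 0\<close> this integrates \<open>law_S_Suc\<close> over an event of
  the past. Negative \<open>t\<close> are covered too, because a law on the real line is determined
  by all half-lines; there the time condition is void and \<open>G\<close> is evaluated at 0, where
  it is 1.\<close>

lemma law_time:
  assumes A: "A \<in> sets (borel_on E)"
  shows "emeasure P {\<omega> \<in> space P. X \<omega> \<in> A \<and> t < R \<omega>} =
    (\<integral>\<^sup>+\<omega>. (if t < T (X \<omega>) then ennreal (G (X \<omega>) (max 0 t)) else 0) * indicator A (X \<omega>) \<partial>P)"
proof (cases "0 \<le> t")
  case True
  have A': "A \<in> sets borel"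
    using A sets_borel_on by simp
  have "emeasure P {\<omega> \<in> space P. X \<omega> \<in> A \<and> t < R \<omega>}
      = emeasure P ({\<omega> \<in> space P. t < R \<omega>} \<inter> {\<omega> \<in> space P. X \<omega> \<in> A})"
    by (intro arg_cong[where f = "emeasure P"]) auto
  also have "\<dots> = (\<integral>\<^sup>+\<omega>. ennreal (G (X \<omega>) t * (if ereal t < exit_time E \<Phi> (X \<omega>) then 1 else 0)) *
      indicator {\<omega> \<in> space P. X \<omega> \<in> A} \<omega> \<partial>P)"
    using law_S_Suc[OF True]
    by (intro emeasure_Int_of_cond_prob[OF _ _ history_of_X[OF A']])
      (auto simp: history_of_def intro!: subalgebra_vimage past_measurable)
  also have "\<dots> = (\<integral>\<^sup>+\<omega>. (if t < T (X \<omega>) then ennreal (G (X \<omega>) (max 0 t)) else 0) * indicator A (X \<omega>) \<partial>P)"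
    using True by (intro nn_integral_cong) (auto simp: exit_time_eq Z_in_E indicator_def)
  finally show ?thesis .
next
  case False
  have "{\<omega> \<in> space P. X \<omega> \<in> A \<and> t < R \<omega>} = X -` A \<inter> space P"
    using False by (auto intro: less_le_trans[OF _ S_nonneg])
  then have "emeasure P {\<omega> \<in> space P. X \<omega> \<in> A \<and> t < R \<omega>} = (\<integral>\<^sup>+\<omega>. indicator (X -` A \<inter> space P) \<omega> \<partial>P)"
    using measurable_sets[OF Z_measurable A] by simp
  also have "\<dots> = (\<integral>\<^sup>+\<omega>. (if t < T (X \<omega>) then ennreal (G (X \<omega>) (max 0 t)) else 0) * indicator A (X \<omega>) \<partial>P)"
    using False less_le_trans[OF _ T_nonneg, of t]
    by (intro nn_integral_cong) (auto simp: G_0 indicator_def max_def)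
  finally show ?thesis .
qed

text \<open>Representing the pair on \<open>P \<Otimes>\<^sub>M lborel\<close> replaces the abstract
  conditional law of the time by an explicit inner Lebesgue integral.\<close>

lemma law_time_eq:
  "distr P (borel_on E \<Otimes>\<^sub>M borel) (\<lambda>\<omega>. (X \<omega>, R \<omega>)) =
   distr (density (P \<Otimes>\<^sub>M lborel) (\<lambda>(\<omega>, u). ennreal (w (X \<omega>) u))) (borel_on E \<Otimes>\<^sub>M borel)
     (\<lambda>(\<omega>, u). (X \<omega>, jump (X \<omega>) u))" (is "?M = ?N")
proof (rule measure_eqI_rectangles)
  fix A and B :: "real set"
  assume A [measurable]: "A \<in> sets (borel_on E)" and B [measurable]: "B \<in> sets borel"
  \<comment> \<open>For fixed \<open>A\<close> the event that the location lies in \<open>A\<close>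
    is absorbed into the density. This leaves two measures on the real line, compared on the
    half-lines \<open>{t<..}\<close> through \<open>law_time\<close> and
    \<open>nn_integral_w_1\<close>.\<close>
  let ?M' = "distr (density P (\<lambda>\<omega>. indicator A (X \<omega>))) borel R"
  let ?N' = "distr (density (P \<Otimes>\<^sub>M lborel) (\<lambda>(\<omega>, u). ennreal (w (X \<omega>) u) * indicator A (X \<omega>))) borel
    (\<lambda>(\<omega>, u). jump (X \<omega>) u)"
  have M': "emeasure ?M' C = (\<integral>\<^sup>+\<omega>. indicator A (X \<omega>) * indicator C (R \<omega>) \<partial>P)"
    if [measurable]: "C \<in> sets borel" for C
    by (simp add: nn_integral_indicator[symmetric] nn_integral_distr nn_integral_density
        del: nn_integral_indicator)
  have N': "emeasure ?N' C = (\<integral>\<^sup>+\<omega>. \<integral>\<^sup>+u. ennreal (w (X \<omega>) u) * indicator A (X \<omega>) *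
      indicator C (jump (X \<omega>) u) \<partial>lborel \<partial>P)" if [measurable]: "C \<in> sets borel" for C
    by (simp add: nn_integral_indicator[symmetric] nn_integral_distr nn_integral_density
        lborel.nn_integral_fst[symmetric] del: nn_integral_indicator)
  have "?M' = ?N'"
  proof (rule measure_eqI_lessThan)
    fix t
    have "emeasure ?M' {t<..} = (\<integral>\<^sup>+\<omega>. indicator {\<omega> \<in> space P. X \<omega> \<in> A \<and> t < R \<omega>} \<omega> \<partial>P)"
      unfolding M'[OF borel_open[OF open_greaterThan]]
      by (intro nn_integral_cong) (auto simp: indicator_def)
    also have "\<dots> = emeasure P {\<omega> \<in> space P. X \<omega> \<in> A \<and> t < R \<omega>}"
      by (rule nn_integral_indicator) measurable
    also have "\<dots> = emeasure ?N' {t<..}"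
      unfolding N'[OF borel_open[OF open_greaterThan]] law_time[OF A]
    proof (intro nn_integral_cong)
      fix \<omega> assume "\<omega> \<in> space P"
      then show "(if t < T (X \<omega>) then ennreal (G (X \<omega>) (max 0 t)) else 0) * indicator A (X \<omega>) =
          (\<integral>\<^sup>+u. ennreal (w (X \<omega>) u) * indicator A (X \<omega>) * indicator {t<..} (jump (X \<omega>) u) \<partial>lborel)"
        by (cases "X \<omega> \<in> A") (simp_all add: nn_integral_w_1 Z_in_E)
    qed
    finally show "emeasure ?M' {t<..} = emeasure ?N' {t<..}" .
    have "emeasure ?M' {t<..} \<le> (\<integral>\<^sup>+\<omega>. 1 \<partial>P)"
      unfolding M'[OF borel_open[OF open_greaterThan]]
      by (intro nn_integral_mono) (auto simp: indicator_def)
    then show "emeasure ?M' {t<..} < \<infinity>"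
      by (auto simp: emeasure_space_1 intro: le_less_trans)
  qed simp_all
  then have "emeasure ?M' B = emeasure ?N' B"
    by simp
  moreover have "emeasure ?M (A \<times> B) = emeasure ?M' B"
    unfolding M'[OF B]
    by (simp add: nn_integral_indicator[symmetric] nn_integral_distr indicator_times
        del: nn_integral_indicator)
  moreover have "emeasure ?N (A \<times> B) = emeasure ?N' B"
    unfolding N'[OF B]
    by (simp add: nn_integral_indicator[symmetric] nn_integral_distr nn_integral_density
        lborel.nn_integral_fst[symmetric] indicator_times mult.assoc del: nn_integral_indicator)
  ultimately show "emeasure ?M (A \<times> B) = emeasure ?N (A \<times> B)"
    by simp
next
  show "emeasure ?M (space ?M) \<noteq> \<infinity>"
    by (simp add: emeasure_distr space_pair_measure) 
qed simp_all

text \<open>The integral form of \<open>law_time_eq\<close>, for integrands measurable on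
  nonnegative times only. Inserting \<open>max 0\<close> changes nothing, since interarrival times
  and values of \<open>jump\<close> are nonnegative.\<close>

lemma nn_integral_X_R:
  assumes g: "g \<in> borel_measurable (borel_on E \<Otimes>\<^sub>M borel_on {0..})"
  shows "(\<integral>\<^sup>+\<omega>. g (X \<omega>, R \<omega>) \<partial>P) = (\<integral>\<^sup>+\<omega>. \<integral>\<^sup>+u. ennreal (w (X \<omega>) u) * g (X \<omega>, jump (X \<omega>) u) \<partial>lborel \<partial>P)"
proof -
  have [measurable]: "(\<lambda>(x, s). g (x, max 0 s)) \<in> borel_measurable (borel_on E \<Otimes>\<^sub>M borel)"
    using measurable_compose[OF _ g, of "\<lambda>(x, s). (x, max 0 s)" "borel_on E \<Otimes>\<^sub>M borel"]
    by (auto simp: case_prod_beta)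
  have "(\<integral>\<^sup>+\<omega>. g (X \<omega>, R \<omega>) \<partial>P) = (\<integral>\<^sup>+\<omega>. g (X \<omega>, max 0 (R \<omega>)) \<partial>P)"
    by (intro nn_integral_cong) (simp add: S_nonneg max_absorb2)
  also have "\<dots> = (\<integral>\<^sup>+(x, s). g (x, max 0 s) \<partial>distr P (borel_on E \<Otimes>\<^sub>M borel) (\<lambda>\<omega>. (X \<omega>, R \<omega>)))"
    by (simp add: nn_integral_distr)
  also have "\<dots> = (\<integral>\<^sup>+\<omega>. \<integral>\<^sup>+u. ennreal (w (X \<omega>) u) * g (X \<omega>, jump (X \<omega>) u) \<partial>lborel \<partial>P)"
    unfolding law_time_eq
    by (simp add: nn_integral_distr nn_integral_density lborel.nn_integral_fst[symmetric])
      (simp add: jump_def)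
  finally show ?thesis .
qed

text \<open>Conditioning on the past and the next time replaces the event for \<open>Y\<close> by
  the kernel at time \<open>R\<close>; then \<open>R\<close> is exchanged for \<open>jump\<close>
  under the density \<open>w\<close>, and \<open>nn_integral_w_kernel\<close> evaluates the inner
  integral.\<close>

lemma law_endpoints:
  assumes A: "A \<in> sets (borel_on E)" and B: "B \<in> sets (borel_on E)"
  shows "emeasure P {\<omega> \<in> space P. X \<omega> \<in> A \<and> Y \<omega> \<in> B \<and> t < R \<omega>} =
    (\<integral>\<^sup>+\<omega>. \<integral>\<^sup>+y. h t (X \<omega>) y * (indicator A (X \<omega>) * indicator B y) \<partial>\<mu> \<partial>P)"
proof -
  have [measurable_cong]: "sets \<mu> = sets (borel_on E)"
    by (rule sets_\<mu>)
  note [measurable] = A B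
  have A': "A \<in> sets borel" and B': "B \<in> sets borel" "B \<subseteq> E"
    using A B sets_borel_on by simp_all
  let ?k = "\<lambda>x s. emeasure (kernel_along \<Phi> Q x s) B"
  \<comment> \<open>Written with the density \<open>Qt\<close>, this is a parameter integral and
    hence jointly measurable; \<open>g_eq\<close> recovers the kernel wherever it is needed.\<close>
  define g where "g = (\<lambda>(x, s). indicator {t<..} s * indicator A x * (\<integral>\<^sup>+y. ennreal (Qt x s y) * indicator B y \<partial>\<mu>))"
  have g_eq: "g (x, s) = indicator {t<..} s * indicator A x * ?k x s" if "x \<in> E" "0 \<le> s" for x s
    using that by (simp add: g_def kernel_density B')
  have [measurable]: "(\<lambda>p. Qt (fst (fst p)) (snd (fst p)) (snd p))
      \<in> borel_measurable ((borel_on E \<Otimes>\<^sub>M borel_on {0..}) \<Otimes>\<^sub>M borel_on E)"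
    using measurable_compose[OF _ Qt_measurable,
        of "\<lambda>p. (fst (fst p), snd (fst p), snd p)" "(borel_on E \<Otimes>\<^sub>M borel_on {0..}) \<Otimes>\<^sub>M borel_on E"]
    by simp
  have [measurable]: "indicator {t<..} \<in> borel_measurable (borel_on {0..})"
    by (intro measurable_restrict_space1 borel_measurable_indicator) simp
  have g_measurable: "g \<in> borel_measurable (borel_on E \<Otimes>\<^sub>M borel_on {0..})"
    unfolding g_def by measurable
  have "emeasure P {\<omega> \<in> space P. X \<omega> \<in> A \<and> Y \<omega> \<in> B \<and> t < R \<omega>}
      = emeasure P ({\<omega> \<in> space P. Y \<omega> \<in> B} \<inter> {\<omega> \<in> space P. X \<omega> \<in> A \<and> t < R \<omega>})"
    by (intro arg_cong[where f = "emeasure P"]) auto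
  also have "\<dots> = (\<integral>\<^sup>+\<omega>. ennreal (measure (kernel_along \<Phi> Q (X \<omega>) (R \<omega>)) B) *
      indicator {\<omega> \<in> space P. X \<omega> \<in> A \<and> t < R \<omega>} \<omega> \<partial>P)"
  proof (rule emeasure_Int_of_cond_prob[OF _ _ history_and_next_time_X_R[OF A'] law_Z_Suc[OF B']])
    show "subalgebra P (history_and_next_time P Z S n)"
      unfolding history_and_next_time_def
      using past_measurable by (intro subalgebra_vimage measurable_Pair) simp_all
  qed measurable
  also have "\<dots> = (\<integral>\<^sup>+\<omega>. g (X \<omega>, R \<omega>) \<partial>P)"
  proof (intro nn_integral_cong)
    fix \<omega> assume \<omega>: "\<omega> \<in> space P"
    interpret k: prob_space "kernel_along \<Phi> Q (X \<omega>) (R \<omega>)"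
      using \<omega> by (intro prob_kernel_along Z_in_E S_nonneg)
    show "ennreal (measure (kernel_along \<Phi> Q (X \<omega>) (R \<omega>)) B) *
        indicator {\<omega> \<in> space P. X \<omega> \<in> A \<and> t < R \<omega>} \<omega> = g (X \<omega>, R \<omega>)"
      using \<omega> by (cases "X \<omega> \<in> A"; cases "t < R \<omega>")
        (simp_all add: g_eq Z_in_E S_nonneg k.emeasure_eq_measure)
  qed
  also have "\<dots> = (\<integral>\<^sup>+\<omega>. \<integral>\<^sup>+u. ennreal (w (X \<omega>) u) * g (X \<omega>, jump (X \<omega>) u) \<partial>lborel \<partial>P)"
    by (rule nn_integral_X_R[OF g_measurable])
  also have "\<dots> = (\<integral>\<^sup>+\<omega>. \<integral>\<^sup>+y. h t (X \<omega>) y * (indicator A (X \<omega>) * indicator B y) \<partial>\<mu> \<partial>P)"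
  proof (intro nn_integral_cong)
    fix \<omega> assume "\<omega> \<in> space P"
    then show "(\<integral>\<^sup>+u. ennreal (w (X \<omega>) u) * g (X \<omega>, jump (X \<omega>) u) \<partial>lborel)
        = (\<integral>\<^sup>+y. h t (X \<omega>) y * (indicator A (X \<omega>) * indicator B y) \<partial>\<mu>)"
      using nn_integral_w_kernel[of "X \<omega>" B t] B
      by (cases "X \<omega> \<in> A") (simp_all add: g_eq Z_in_E jump_nonneg mult.assoc)
  qed
  finally show ?thesis .
qed

text \<open>Both sides are integrals of \<open>g\<close> against finite measures on pairs of
  locations, which agree on rectangles by \<open>law_endpoints\<close>.\<close>

lemma nn_integral_endpoints:
  assumes [measurable]: "g \<in> borel_measurable (borel_on E \<Otimes>\<^sub>M borel_on E)"
  shows "(\<integral>\<^sup>+\<omega>. indicator {t<..} (R \<omega>) * g (X \<omega>, Y \<omega>) \<partial>P) =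
    (\<integral>\<^sup>+\<omega>. \<integral>\<^sup>+y. h t (X \<omega>) y * g (X \<omega>, y) \<partial>\<mu> \<partial>P)"
proof -
  have [measurable_cong]: "sets \<mu> = sets (borel_on E)"
    by (rule sets_\<mu>)
  let ?K = "borel_on E \<Otimes>\<^sub>M borel_on E"
  let ?M = "distr (density P (\<lambda>\<omega>. indicator {t<..} (R \<omega>))) ?K (\<lambda>\<omega>. (X \<omega>, Y \<omega>))"
  let ?N = "distr (density (P \<Otimes>\<^sub>M \<mu>) (\<lambda>(\<omega>, y). h t (X \<omega>) y)) ?K (\<lambda>(\<omega>, y). (X \<omega>, y))"
  have M: "(\<integral>\<^sup>+p. k p \<partial>?M) = (\<integral>\<^sup>+\<omega>. indicator {t<..} (R \<omega>) * k (X \<omega>, Y \<omega>) \<partial>P)"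
    if [measurable]: "k \<in> borel_measurable ?K" for k
    by (simp add: nn_integral_distr nn_integral_density)
  have N: "(\<integral>\<^sup>+p. k p \<partial>?N) = (\<integral>\<^sup>+\<omega>. \<integral>\<^sup>+y. h t (X \<omega>) y * k (X \<omega>, y) \<partial>\<mu> \<partial>P)"
    if [measurable]: "k \<in> borel_measurable ?K" for k
    by (simp add: nn_integral_distr nn_integral_density \<mu>.nn_integral_fst[symmetric])
  have "?M = ?N"
  proof (rule measure_eqI_rectangles)
    fix A B assume AB [measurable]: "A \<in> sets (borel_on E)" "B \<in> sets (borel_on E)"
    have "emeasure ?M (A \<times> B) = (\<integral>\<^sup>+p. indicator (A \<times> B) p \<partial>?M)"
      by (rule nn_integral_indicator[symmetric]) simp
    also have "\<dots> = (\<integral>\<^sup>+\<omega>. indicator {\<omega> \<in> space P. X \<omega> \<in> A \<and> Y \<omega> \<in> B \<and> t < R \<omega>} \<omega> \<partial>P)"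
      unfolding M[OF borel_measurable_indicator[OF pair_measureI[OF AB]]]
      by (intro nn_integral_cong) (auto simp: indicator_def)
    also have "\<dots> = emeasure P {\<omega> \<in> space P. X \<omega> \<in> A \<and> Y \<omega> \<in> B \<and> t < R \<omega>}"
      by (rule nn_integral_indicator) measurable
    also have "\<dots> = (\<integral>\<^sup>+p. indicator (A \<times> B) p \<partial>?N)"
      by (subst N) (simp_all add: law_endpoints indicator_times)
    also have "\<dots> = emeasure ?N (A \<times> B)"
      by (rule nn_integral_indicator) simp
    finally show "emeasure ?M (A \<times> B) = emeasure ?N (A \<times> B)" .
  next
    have "emeasure ?M (space ?M) = (\<integral>\<^sup>+p. 1 \<partial>?M)"
      by simp
    also have "\<dots> \<le> (\<integral>\<^sup>+\<omega>. 1 \<partial>P)"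
      unfolding M[OF borel_measurable_const] by (intro nn_integral_mono) (simp add: indicator_def)
    finally show "emeasure ?M (space ?M) \<noteq> \<infinity>"
      by (auto simp: emeasure_space_1 top_unique)
  qed simp_all
  then show ?thesis
    using M[of g] N[of g] by simp
qed

section \<open>The conditional probability as a quotient of densities\<close>

definition ratio :: "real \<Rightarrow> 'a \<Rightarrow> 'a \<Rightarrow> real" where
  "ratio t x y = enn2real (h t x y) / enn2real (h (-1) x y)"

lemma h_whole: "x \<in> E \<Longrightarrow> y \<in> E \<Longrightarrow> h (-1) x y = ennreal (H x y 0)"
  using T_nonneg[of x] by (simp add: h_eq)

text \<open>On \<open>E\<close> the denominator \<open>H x y 0\<close> is positive and finite, so it
  cancels. This exchanges the unrestricted weight for the one restricted to late jumps.\<close>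

lemma ratio_mult_h:
  assumes "x \<in> E" "y \<in> E"
  shows "ennreal (ratio t x y) * h (-1) x y = h t x y"
  using H_pos[OF assms, of 0] H_pos[OF assms, of "max 0 t"] T_nonneg[of x]
  by (auto simp: ratio_def h_whole assms h_eq ennreal_mult'[symmetric])

text \<open>Before \<open>T x\<close> the quotient of values of \<open>H\<close> is given by
  \<open>exp_cond_rate\<close>; from \<open>T x\<close> on the numerator is 0, which is the
  indicator in the formula.\<close>

lemma ratio_eq:
  assumes "x \<in> E" "y \<in> E" "0 \<le> t"
  shows "ratio t x y = exp (- (LBINT s:{0..min t (T x)}. cond_rate E \<Phi> lam Qt x y s)) *
    (if ereal t < exit_time E \<Phi> x then 1 else 0)"
  using H_pos[OF assms(1,2), of 0] H_pos[OF assms] T_nonneg[of x]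
  by (auto simp: ratio_def h_whole h_eq assms exit_time_eq exp_cond_rate min_absorb1)

lemma ratio_nonneg: "0 \<le> ratio t x y"
  by (simp add: ratio_def)

text \<open>Defining \<open>ratio\<close> through \<open>h\<close> makes joint measurability in both
  endpoints a matter of parameter integrals; the exponential formula then only has to hold
  pointwise.\<close>

lemma ratio_measurable [measurable]: "(\<lambda>(x, y). ratio t x y) \<in> borel_measurable (borel_on E \<Otimes>\<^sub>M borel_on E)"
  unfolding ratio_def by measurable

lemma subalgebra_endpoints: "subalgebra P (endpoints P Z n)"
  unfolding endpoints_def using Z_borel by (intro subalgebra_vimage measurable_Pair)

text \<open>\<open>endpoints\<close> is generated by Borel sets of the whole type, whereas
  \<open>ratio\<close> is measurable on \<open>E\<close> only. The chain stays in \<open>E\<close>,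
  so the map may be restricted in its target.\<close>

lemma endpoints_measurable:
  "(\<lambda>\<omega>. (X \<omega>, Y \<omega>)) \<in> endpoints P Z n \<rightarrow>\<^sub>M borel_on E \<Otimes>\<^sub>M borel_on E"
proof -
  have *: "(\<lambda>\<omega>. (X \<omega>, Y \<omega>)) \<in> endpoints P Z n \<rightarrow>\<^sub>M borel \<Otimes>\<^sub>M borel"
    unfolding endpoints_def by (rule measurable_vimage_algebra1) (simp add: space_pair_measure)
  have "space (endpoints P Z n) = space P"
    by (simp add: endpoints_def)
  then show ?thesis
    using measurable_compose[OF * measurable_fst] measurable_compose[OF * measurable_snd]
    by (intro measurable_Pair measurable_restrict_space2) (auto simp: Z_in_E)
qed

text \<open>By the characterization of conditional expectation it suffices to compare integrals over
  events of the form \<open>(X, Y) \<in> D\<close>. There the weight \<open>h (-1)\<close> times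
  \<open>ratio t\<close> is \<open>h t\<close>, whose integral is the probability of the event
  together with \<open>t < R\<close>.\<close>

lemma cond_prob_R_endpoints:
  "AE \<omega> in P. real_cond_exp P (endpoints P Z n) (indicator {\<omega> \<in> space P. t < R \<omega>}) \<omega> = ratio t (X \<omega>) (Y \<omega>)"
proof -
  interpret finite_measure_subalgebra P "endpoints P Z n"
    by unfold_locales (rule subalgebra_endpoints)
  let ?A = "{\<omega> \<in> space P. t < R \<omega>}"
  have A [measurable]: "?A \<in> sets P"
    by measurable
  have key: "(\<integral>\<^sup>+\<omega>\<in>C. ennreal (ratio t (X \<omega>) (Y \<omega>)) \<partial>P) = (\<integral>\<^sup>+\<omega>\<in>C. ennreal (indicator ?A \<omega>) \<partial>P)"
    if C: "C \<in> sets (endpoints P Z n)" for C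
  proof -
    obtain D where D: "D \<in> sets (borel \<Otimes>\<^sub>M borel)" "C = (\<lambda>\<omega>. (X \<omega>, Y \<omega>)) -` D \<inter> space P"
      using C unfolding endpoints_def by (subst (asm) sets_vimage_algebra2) (auto simp: space_pair_measure)
    \<comment> \<open>\<open>D\<close> is Borel in the product of the whole type; measurability of
      the inclusion transfers its indicator to pairs from \<open>E\<close>.\<close>
    have "id \<in> borel_on E \<Otimes>\<^sub>M borel_on E \<rightarrow>\<^sub>M borel \<Otimes>\<^sub>M borel"
      using measurable_fst[of "borel_on E" "borel_on E"] measurable_snd[of "borel_on E" "borel_on E"]
      by (intro measurable_pair) (simp_all add: measurable_restrict_space2_iff)
    from measurable_compose[OF this borel_measurable_indicator[OF D(1)]]
    have [measurable]: "(indicator D :: _ \<Rightarrow> ennreal) \<in> borel_measurable (borel_on E \<Otimes>\<^sub>M borel_on E)"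
      by simp
    \<comment> \<open>Interarrival times are nonnegative, so the threshold -1 is always exceeded,
      and inserting its indicator brings the integral into the form of
      \<open>nn_integral_endpoints\<close>.\<close>
    have "(\<integral>\<^sup>+\<omega>\<in>C. ennreal (ratio t (X \<omega>) (Y \<omega>)) \<partial>P)
        = (\<integral>\<^sup>+\<omega>. indicator {-1<..} (R \<omega>) *
            (case (X \<omega>, Y \<omega>) of (x, y) \<Rightarrow> ennreal (ratio t x y) * indicator D (x, y)) \<partial>P)"
    proof (intro nn_integral_cong)
      fix \<omega> assume \<omega>: "\<omega> \<in> space P"
      then have "-1 < R \<omega>"
        using S_nonneg[OF \<omega>, of "Suc n"] by simp
      then show "ennreal (ratio t (X \<omega>) (Y \<omega>)) * indicator C \<omega> = indicator {-1<..} (R \<omega>) *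
          (case (X \<omega>, Y \<omega>) of (x, y) \<Rightarrow> ennreal (ratio t x y) * indicator D (x, y))"
        using \<omega> by (simp add: D(2) indicator_def)
    qed
    also have "\<dots> = (\<integral>\<^sup>+\<omega>. \<integral>\<^sup>+y. h (-1) (X \<omega>) y *
        (case (X \<omega>, y) of (x, y) \<Rightarrow> ennreal (ratio t x y) * indicator D (x, y)) \<partial>\<mu> \<partial>P)"
      by (rule nn_integral_endpoints) measurable
    also have "\<dots> = (\<integral>\<^sup>+\<omega>. \<integral>\<^sup>+y. h t (X \<omega>) y * indicator D (X \<omega>, y) \<partial>\<mu> \<partial>P)"
    proof (intro nn_integral_cong)
      fix \<omega> y assume "\<omega> \<in> space P" "y \<in> space \<mu>"
      then have *: "h t (X \<omega>) y = ennreal (ratio t (X \<omega>) y) * h (-1) (X \<omega>) y"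
        by (simp add: ratio_mult_h space_\<mu> Z_in_E)
      show "h (-1) (X \<omega>) y * (case (X \<omega>, y) of (x, y) \<Rightarrow> ennreal (ratio t x y) * indicator D (x, y)) =
          h t (X \<omega>) y * indicator D (X \<omega>, y)"
        unfolding * prod.case by (simp only: mult_ac)
    qed
    also have "\<dots> = (\<integral>\<^sup>+\<omega>. indicator {t<..} (R \<omega>) * indicator D (X \<omega>, Y \<omega>) \<partial>P)"
      by (rule nn_integral_endpoints[symmetric]) measurable
    also have "\<dots> = (\<integral>\<^sup>+\<omega>\<in>C. ennreal (indicator ?A \<omega>) \<partial>P)"
      by (intro nn_integral_cong) (auto simp: D(2) indicator_def)
    finally show ?thesis .
  qed
  have meas: "(\<lambda>\<omega>. ratio t (X \<omega>) (Y \<omega>)) \<in> borel_measurable (endpoints P Z n)"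
    using measurable_compose[OF endpoints_measurable ratio_measurable] by simp
  have meas' [measurable]: "(\<lambda>\<omega>. ratio t (X \<omega>) (Y \<omega>)) \<in> borel_measurable P"
    using measurable_from_subalg[OF subalgebra_endpoints meas] .
  show ?thesis
  proof (rule real_cond_exp_charact[OF _ _ _ meas])
    show "integrable P (indicator ?A :: _ \<Rightarrow> real)"
      by (simp add: less_top[symmetric])
    \<comment> \<open>Integrability follows from \<open>key\<close> itself on the whole space, where
      the integral of \<open>ratio\<close> is the probability of \<open>?A\<close>.\<close>
    have "(\<integral>\<^sup>+\<omega>. ennreal (ratio t (X \<omega>) (Y \<omega>)) \<partial>P)
        = (\<integral>\<^sup>+\<omega>\<in>space (endpoints P Z n). ennreal (ratio t (X \<omega>) (Y \<omega>)) \<partial>P)"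
      by (intro nn_integral_cong) (simp add: endpoints_def)
    also have "\<dots> = (\<integral>\<^sup>+\<omega>\<in>space (endpoints P Z n). ennreal (indicator ?A \<omega>) \<partial>P)"
      by (rule key[OF sets.top])
    also have "\<dots> \<le> (\<integral>\<^sup>+\<omega>. 1 \<partial>P)"
      by (intro nn_integral_mono) (simp add: indicator_def)
    finally have "(\<integral>\<^sup>+\<omega>. ennreal (ratio t (X \<omega>) (Y \<omega>)) \<partial>P) < \<infinity>"
      by (auto simp: emeasure_space_1 intro: le_less_trans)
    then show "integrable P (\<lambda>\<omega>. ratio t (X \<omega>) (Y \<omega>))"
      by (intro integrableI_nonneg) (auto simp: ratio_nonneg)
    fix C assume C: "C \<in> sets (endpoints P Z n)"
    then have [measurable]: "C \<in> sets P"
      using subalgebra_endpoints by (auto simp: subalgebra_def)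
    \<comment> \<open>The characterization speaks of Bochner integrals and \<open>key\<close> of
      nonnegative ones; for nonnegative functions \<open>enn2real\<close> links the two.\<close>
    have "(\<integral>\<omega>\<in>C. k \<omega> \<partial>P) = enn2real (\<integral>\<^sup>+\<omega>\<in>C. ennreal (k \<omega>) \<partial>P)"
      if [measurable]: "k \<in> borel_measurable P" and "\<And>\<omega>. 0 \<le> k \<omega>" for k
      unfolding set_lebesgue_integral_def using that(2)
      by (subst integral_eq_nn_integral)
        (auto intro!: arg_cong[where f = enn2real] nn_integral_cong simp: indicator_def)
    then show "(\<integral>\<omega>\<in>C. indicator ?A \<omega> \<partial>P) = (\<integral>\<omega>\<in>C. ratio t (X \<omega>) (Y \<omega>) \<partial>P)"
      using key[OF C] by (simp add: ratio_nonneg)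
  qed
qed

end

theorem proposition3p5:
  fixes E :: "'a::{metric_space, second_countable_topology} set"
    and \<Phi> :: "'a \<Rightarrow> real \<Rightarrow> 'a"
    and lam :: "'a \<Rightarrow> real"
    and Q :: "'a \<Rightarrow> 'a measure"
    and P :: "'w measure"
    and \<nu>\<^sub>0 :: "'a measure"
    and Z :: "nat \<Rightarrow> 'w \<Rightarrow> 'a"
    and S :: "nat \<Rightarrow> 'w \<Rightarrow> real"
    and \<mu> :: "'a measure"
    and Qt :: "'a \<Rightarrow> real \<Rightarrow> 'a \<Rightarrow> real"
    and n :: nat
    and t :: real
  assumes chain: "pdmp_chain E \<Phi> lam Q P \<nu>\<^sub>0 Z S"
    and mu_sets: "sets \<mu> = sets (borel_on E)"
    and mu_pos: "\<And>B. \<lbrakk>B \<in> sets \<mu>; interior B \<noteq> {}\<rbrakk> \<Longrightarrow> 0 < emeasure \<mu> B"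
    and Qt_measurable: "(\<lambda>(x, s, y). Qt x s y) \<in>
          borel_measurable (borel_on E \<Otimes>\<^sub>M borel_on {0..} \<Otimes>\<^sub>M borel_on E)"
    and a1a: "\<And>\<xi> s B. \<lbrakk>\<xi> \<in> E; 0 \<le> s; B \<in> sets borel; B \<subseteq> E\<rbrakk> \<Longrightarrow>
          emeasure (kernel_along \<Phi> Q \<xi> s) B = (\<integral>\<^sup>+ y \<in> B. ennreal (Qt \<xi> s y) \<partial>\<mu>)"
    and a1b: "\<And>x y. \<lbrakk>x \<in> E; y \<in> E\<rbrakk> \<Longrightarrow> continuous_on {0..} (\<lambda>s. Qt x s y)"
    and a1c: "\<exists>m>0. \<forall>x\<in>E. \<forall>y\<in>E. \<forall>s\<ge>0. m \<le> Qt x s y"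
    and a1d: "\<And>e. 0 < e \<Longrightarrow> \<exists>p\<ge>(2::nat). \<exists>B :: nat \<Rightarrow> 'a set.
          (\<forall>k\<in>{1..p}. B k \<in> C1 E \<and> bounded (B k) \<and> diameter (B k) < e) \<and>
          disjoint_family_on B {1..p} \<and>
          (\<forall>x\<in>E. \<forall>t\<ge>0. (\<Sum>k=1..p. emeasure (kernel_along \<Phi> Q x t) (B k)) = 1)"
    and a2a: "\<And>\<xi>. \<xi> \<in> E \<Longrightarrow> continuous_on {0..} (dens \<Phi> lam \<xi>) \<and> (\<forall>t\<ge>0. 0 < dens \<Phi> lam \<xi> t)"
    and a2b: "\<exists>M :: real \<Rightarrow> real. (\<forall>t\<ge>0. 0 \<le> M t) \<and> (\<forall>T\<ge>0. set_integrable lborel {0..T} M) \<and>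
          (\<forall>\<xi>\<in>E. \<forall>t\<ge>0. rate_along \<Phi> lam \<xi> t \<le> M t)"
    and a2c: "\<exists>T :: real. \<forall>\<xi>\<in>E. exit_time E \<Phi> \<xi> \<le> ereal T"
    and a2d: "\<exists>L :: real. \<forall>x\<in>E. \<forall>y\<in>E. \<forall>u\<in>E. \<forall>v\<in>E. \<forall>t\<ge>0.
          ereal t < min (exit_time E \<Phi> x) (exit_time E \<Phi> u) \<longrightarrow>
          \<bar>dens \<Phi> lam x t * Qt x t y - dens \<Phi> lam u t * Qt u t v\<bar> \<le> L * d2 (x, y) (u, v)"
    and a2e: "\<exists>L :: real. \<forall>x\<in>E. \<forall>y\<in>E. \<forall>t\<ge>0.
          \<bar>dens \<Phi> lam x t - dens \<Phi> lam y t\<bar> \<le> L * dist x y"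
    and a2f: "\<exists>L :: real. \<forall>x\<in>E. \<forall>y\<in>E. \<forall>u\<in>E. \<forall>v\<in>E.
          (let tx = real_of_ereal (exit_time E \<Phi> x); tu = real_of_ereal (exit_time E \<Phi> u) in
           \<bar>surv \<Phi> lam x tx * Qt x tx y - surv \<Phi> lam u tu * Qt u tu v\<bar> \<le> L * d2 (x, y) (u, v))"
    and t_nonneg: "0 \<le> t"
  shows "AE \<omega> in P.
     real_cond_exp P (endpoints P Z n) (indicator {\<omega> \<in> space P. t < S (Suc n) \<omega>}) \<omega> =
     exp (- (LBINT s:{0..min t (real_of_ereal (exit_time E \<Phi> (Z n \<omega>)))}.
               cond_rate E \<Phi> lam Qt (Z n \<omega>) (Z (Suc n) \<omega>) s)) *
     (if ereal t < exit_time E \<Phi> (Z n \<omega>) then 1 else 0)"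
proof -
  interpret chain: pdmp_chain E \<Phi> lam Q P \<nu>\<^sub>0 Z S
    by (rule chain)
  interpret pdmp_density_chain E \<Phi> lam Q P \<nu>\<^sub>0 Z S \<mu> Qt n
    using a1c a2a a2b a2c
    by unfold_locales (rule mu_sets Qt_measurable a1a a1b | blast)+
  show ?thesis
    \<comment> \<open>\<open>AE_space\<close> places the sample point in the space of
      \<open>P\<close>, so both locations lie in \<open>E\<close> and \<open>ratio_eq\<close>
      applies.\<close>
    using cond_prob_R_endpoints[of t] AE_space
    by eventually_elim (simp add: ratio_eq Z_in_E t_nonneg T_def)
qed

end
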